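(* For every triple of density matrices $\rho_1,\rho_2,\rho_3$ on a finite-dimensional complex Hilbert space of arbitrary dimension, the quantity $\beta=F(\{1,2,3\})-F(\{1,2\})-F(\{1,3\})-F(\{2,3\})$ satisfies $$\beta\le\frac{3\sqrt{15}-9}{4}<\frac23.$$
   Context: For density matrices $\rho_1,\rho_2,\rho_3$ and nonempty $H\subseteq\{1,2,3\}$, the minimum unnormalized discrimination error is $F(H)=|H|-D(H)$, where $D(H)=\max\sum_{i\in H}\operatorname{Tr}(\rho_iM_i)$, the maximum over all POVMs $(M_i)_{i\in H}$ (i.e. $M_i\ge0$, $\sum_{i\in H}M_i=\mathbb I$). *)

theory Defs
  imports "HOL-Analysis.Analysis"
begin

definition cinner :: "complex^'n \<Rightarrow> complex^'n \<Rightarrow> complex" where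
  "cinner v w = (\<Sum>i\<in>UNIV. cnj (v $ i) * w $ i)"

definition hermitian :: "complex^'n^'n \<Rightarrow> bool" where
  "hermitian A \<longleftrightarrow> (\<forall>i j. A $ j $ i = cnj (A $ i $ j))"

text \<open>For Hermitian \<open>A\<close> the number \<open>cinner v (A *v v)\<close> is real, so \<open>Re\<close> loses nothing.\<close>

definition psd :: "complex^'n^'n \<Rightarrow> bool" where
  "psd A \<longleftrightarrow> hermitian A \<and> (\<forall>v. 0 \<le> Re (cinner v (A *v v)))"

definition density_matrix :: "complex^'n^'n \<Rightarrow> bool" where
  "density_matrix A \<longleftrightarrow> psd A \<and> trace A = 1"

text \<open>Only the operators \<open>M i\<close> with \<open>i \<in> H\<close> belong to the measurement; the other values are ignored.\<close>

definition povm :: "nat set \<Rightarrow> (nat \<Rightarrow> complex^'n^'n) \<Rightarrow> bool" where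
  "povm H M \<longleftrightarrow> (\<forall>i\<in>H. psd (M i)) \<and> (\<Sum>i\<in>H. M i) = mat 1"

text \<open>The trace of a product of two Hermitian matrices is real, so \<open>Re\<close> again loses nothing.\<close>

definition score :: "(nat \<Rightarrow> complex^'n^'n) \<Rightarrow> nat set \<Rightarrow> (nat \<Rightarrow> complex^'n^'n) \<Rightarrow> real" where
  "score \<rho> H M = (\<Sum>i\<in>H. Re (trace (\<rho> i ** M i)))"

lemma cinner_two:
  fixes A :: "complex^'n^'n"
  assumes "i \<noteq> j"
  shows "cinner (axis i 1 + axis j c) (A *v (axis i 1 + axis j c)) =
    A $ i $ i + c * A $ i $ j + cnj c * A $ j $ i + cnj c * c * A $ j $ j"
proof -
  have mv: "(A *v (axis i 1 + axis j c)) $ k = A $ k $ i + c * A $ k $ j" for k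
    by (simp add: matrix_vector_mult_def axis_def distrib_left sum.distrib
        if_distrib[of "\<lambda>x. _ * x"] cong: if_cong)
  have "cinner (axis i 1 + axis j c) w = w $ i + cnj c * w $ j" for w :: "complex^'n"
    by (simp add: cinner_def axis_def distrib_right sum.distrib if_distrib[of cnj]
        if_distrib[of "\<lambda>x. x * _"] cong: if_cong)
  then show ?thesis by (simp only: mv) (simp add: algebra_simps)
qed

lemma psd_diag:
  assumes "psd A" shows "0 \<le> Re (A $ i $ i)"
proof -
  have "cinner (axis i 1) (A *v axis i 1) = A $ i $ i"
    by (simp add: cinner_def axis_def matrix_vector_mult_def if_distrib if_distribR cong: if_cong)
  then show ?thesis using assms unfolding psd_def by metis
qed

lemma psd_entry:
  assumes "psd A" and "\<And>k. Re (A $ k $ k) \<le> 1"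
  shows "cmod (A $ i $ j) \<le> 2"
proof -
  have h: "A $ j $ i = cnj (A $ i $ j)" for i j
    using assms(1) unfolding psd_def hermitian_def by blast
  have "\<bar>Re (A $ i $ j)\<bar> \<le> 1 \<and> \<bar>Im (A $ i $ j)\<bar> \<le> 1"
  proof (cases "i = j")
    case True
    have "Im (A $ i $ i) = 0" using arg_cong[OF h[of i i], of Im] by simp
    then show ?thesis using True psd_diag[OF assms(1), of i] assms(2)[of i] by (simp add: abs_le_iff)
  next
    case False
    have p: "0 \<le> Re (A $ i $ i + c * A $ i $ j + cnj c * A $ j $ i + cnj c * c * A $ j $ j)" for c
      using assms(1) cinner_two[OF False, of c A] unfolding psd_def by metis
    have "Re (A $ j $ i) = Re (A $ i $ j)" "Im (A $ j $ i) = - Im (A $ i $ j)"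
      by (simp_all only: h[of j i] cnj.sel)
    moreover have "0 \<le> Re (A $ i $ i) + Re (A $ i $ j) + Re (A $ j $ i) + Re (A $ j $ j)"
      using p[of 1] by simp
    moreover have "0 \<le> Re (A $ i $ i) - Re (A $ i $ j) - Re (A $ j $ i) + Re (A $ j $ j)"
      using p[of "-1"] by simp
    moreover have "0 \<le> Re (A $ i $ i) - Im (A $ i $ j) + Im (A $ j $ i) + Re (A $ j $ j)"
      using p[of \<i>] by simp
    moreover have "0 \<le> Re (A $ i $ i) + Im (A $ i $ j) - Im (A $ j $ i) + Re (A $ j $ j)"
      using p[of "-\<i>"] by simp
    ultimately show ?thesis using assms(2)[of i] assms(2)[of j] by linarith
  qed
  then show ?thesis using cmod_le[of "A $ i $ j"] by linarith
qed

lemma povm_entry: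
  assumes "finite H" "povm H M" "i \<in> H"
  shows "cmod (M i $ a $ b) \<le> 2"
proof (rule psd_entry)
  show "psd (M i)" using assms by (auto simp: povm_def)
  fix k
  have "(\<Sum>i\<in>H. Re (M i $ k $ k)) = Re ((\<Sum>i\<in>H. M i) $ k $ k)" by (simp add: sum_component)
  also have "\<dots> = 1" using assms by (simp add: povm_def mat_def)
  finally have "(\<Sum>i\<in>H. Re (M i $ k $ k)) = 1" .
  moreover have "Re (M i $ k $ k) \<le> (\<Sum>i\<in>H. Re (M i $ k $ k))"
    using assms psd_diag by (intro member_le_sum) (auto simp: povm_def)
  ultimately show "Re (M i $ k $ k) \<le> 1" by simp
qed

lemma povm_norm:
  fixes M :: "nat \<Rightarrow> complex^'n^'n"
  assumes "finite H" "povm H M" "i \<in> H"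
  shows "norm (M i) \<le> (\<Sum>a\<in>(UNIV::'n set). \<Sum>b\<in>(UNIV::'n set). 2)"
proof -
  have "norm (M i) \<le> (\<Sum>a\<in>UNIV. norm (M i $ a))"
    unfolding norm_vec_def[of "M i"] by (rule L2_set_le_sum) simp
  also have "\<dots> \<le> (\<Sum>a\<in>UNIV. \<Sum>b\<in>UNIV. norm (M i $ a $ b))"
    by (rule sum_mono, subst norm_vec_def, rule L2_set_le_sum) simp
  also have "\<dots> \<le> (\<Sum>a\<in>(UNIV::'n set). \<Sum>b\<in>(UNIV::'n set). 2)"
    using povm_entry[OF assms] by (intro sum_mono) auto
  finally show ?thesis .
qed

lemma povm_exists:
  assumes "finite H" "H \<noteq> {}"
  shows "\<exists>M :: nat \<Rightarrow> complex^'n^'n. povm H M"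
proof -
  obtain h where h: "h \<in> H" using assms by blast
  have z: "psd (0 :: complex^'n^'n)"
    by (simp add: psd_def hermitian_def cinner_def)
  have o: "psd (mat 1 :: complex^'n^'n)"
  proof -
    have "0 \<le> Re (\<Sum>i\<in>UNIV. cnj (v $ i) * v $ i)" for v :: "complex^'n"
      unfolding Re_sum by (intro sum_nonneg) simp
    then show ?thesis by (auto simp: psd_def hermitian_def cinner_def mat_def[of 1])
       (auto simp: mat_def[symmetric])
  qed
  have "povm H (\<lambda>i. if i = h then mat 1 else 0 :: complex^'n^'n)"
    using assms h z o by (auto simp: povm_def sum.delta)
  then show ?thesis by blast
qed

lemma continuous_on_entry:
  "continuous_on S (\<lambda>M :: nat \<Rightarrow> complex^'n^'n. M i $ a $ b)"
proof -
  have "continuous_on S (\<lambda>M :: nat \<Rightarrow> complex^'n^'n. M i)"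
    by (rule continuous_on_subset[OF continuous_on_product_coordinates]) simp
  then show ?thesis by (rule continuous_on_component[OF continuous_on_component])
qed

lemma closed_povm:
  "closed {M :: nat \<Rightarrow> complex^'n^'n. povm H M}"
proof -
  have "povm H M \<longleftrightarrow>
      (\<forall>i. i \<in> H \<longrightarrow> (\<forall>a b. M i $ b $ a = cnj (M i $ a $ b)) \<and>
        (\<forall>v. 0 \<le> Re (\<Sum>a\<in>UNIV. cnj (v $ a) * (\<Sum>b\<in>UNIV. M i $ a $ b * v $ b)))) \<and>
      (\<forall>a b. (\<Sum>i\<in>H. M i $ a $ b) = mat 1 $ a $ b)" for M :: "nat \<Rightarrow> complex^'n^'n"
    by (simp add: povm_def psd_def hermitian_def cinner_def matrix_vector_mult_def Ball_def
        vec_eq_iff)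
  moreover have "closed {M :: nat \<Rightarrow> complex^'n^'n.
      (\<forall>i. i \<in> H \<longrightarrow> (\<forall>a b. M i $ b $ a = cnj (M i $ a $ b)) \<and>
        (\<forall>v. 0 \<le> Re (\<Sum>a\<in>UNIV. cnj (v $ a) * (\<Sum>b\<in>UNIV. M i $ a $ b * v $ b)))) \<and>
      (\<forall>a b. (\<Sum>i\<in>H. M i $ a $ b) = mat 1 $ a $ b)}"
    by (intro closed_Collect_conj closed_Collect_all closed_Collect_imp open_Collect_const
        closed_Collect_le closed_Collect_eq continuous_on_entry continuous_on_Re
        continuous_on_sum continuous_on_mult continuous_on_cnj continuous_on_const)
  ultimately show ?thesis by simp
qed

text \<open>The set of POVMs is compact up to irrelevant values, so the \<open>GREATEST\<close> in \<open>max_success\<close> below exists.\<close>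

lemma score_max_exists:
  fixes \<rho> :: "nat \<Rightarrow> complex^'n^'n"
  assumes "finite H" "H \<noteq> {}"
  shows "\<exists>M. povm H M \<and> (\<forall>N. povm H N \<longrightarrow> score \<rho> H N \<le> score \<rho> H M)"
proof -
  define B where "B = (\<Sum>a\<in>(UNIV::'n set). \<Sum>b\<in>(UNIV::'n set). (2::real))"
  define P :: "(nat \<Rightarrow> complex^'n^'n) set"
    where "P = PiE UNIV (\<lambda>i. if i \<in> H then cball 0 B else {0})"
  define K where "K = {M. povm H M} \<inter> P"
  define r where "r = (\<lambda>(M :: nat \<Rightarrow> complex^'n^'n) i. if i \<in> H then M i else 0)"
  have r: "r M \<in> K" "score \<rho> H (r M) = score \<rho> H M" if "povm H M" for M
  proof -
    have rM: "r M i = M i" if "i \<in> H" for i using that by (simp add: r_def)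
    then have sm: "sum (r M) H = sum M H" by (intro sum.cong) auto
    have "povm H (r M)" using that rM sm unfolding povm_def by simp
    moreover have "r M i \<in> (if i \<in> H then cball 0 B else {0})" for i
      using povm_norm[OF assms(1) that, of i, folded B_def] by (simp add: r_def)
    ultimately show "r M \<in> K" unfolding K_def P_def by blast
    show "score \<rho> H (r M) = score \<rho> H M"
      unfolding score_def by (intro sum.cong) (simp_all add: rM)
  qed
  have "compactin (product_topology (\<lambda>_. euclidean) UNIV) P"
    unfolding P_def compactin_PiE by simp
  then have "compact P" by (simp add: euclidean_product_topology)
  then have K: "compact K" unfolding K_def by (intro closed_Int_compact closed_povm)
  have ne: "K \<noteq> {}" using povm_exists[OF assms] r by blast
  have "continuous_on K (score \<rho> H)"
    unfolding score_def[abs_def] trace_def matrix_matrix_mult_def vec_lambda_beta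
    by (intro continuous_on_Re continuous_on_sum continuous_on_mult continuous_on_const
        continuous_on_entry)
  from continuous_attains_sup[OF K ne this] obtain M
    where M: "M \<in> K" "\<forall>N\<in>K. score \<rho> H N \<le> score \<rho> H M" by blast
  have "score \<rho> H N \<le> score \<rho> H M" if "povm H N" for N
    using M(2) r[OF that] by metis
  moreover have "povm H M" using M(1) by (simp add: K_def)
  ultimately show ?thesis by blast
qed

definition max_success :: "(nat \<Rightarrow> complex^'n^'n) \<Rightarrow> nat set \<Rightarrow> real" where
  "max_success \<rho> H = (GREATEST s. \<exists>M. povm H M \<and> s = score \<rho> H M)"

lemma max_success_is_max:
  assumes "finite H" "H \<noteq> {}"
  shows "\<exists>M. povm H M \<and> max_success \<rho> H = score \<rho> H M"
    and "povm H N \<Longrightarrow> score \<rho> H N \<le> max_success \<rho> H"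
proof -
  obtain M where M: "povm H M" "\<And>N. povm H N \<Longrightarrow> score \<rho> H N \<le> score \<rho> H M"
    using score_max_exists[OF assms] by blast
  have eq: "max_success \<rho> H = score \<rho> H M"
    unfolding max_success_def by (rule Greatest_equality) (use M in auto)
  show "\<exists>M. povm H M \<and> max_success \<rho> H = score \<rho> H M" using M eq by blast
  show "povm H N \<Longrightarrow> score \<rho> H N \<le> max_success \<rho> H" using M eq by simp
qed

definition min_error :: "(nat \<Rightarrow> complex^'n^'n) \<Rightarrow> nat set \<Rightarrow> real" where
  "min_error \<rho> H = real (card H) - max_success \<rho> H"

definition beta :: "(nat \<Rightarrow> complex^'n^'n) \<Rightarrow> real" where
  "beta \<rho> = min_error \<rho> {1, 2, 3} - min_error \<rho> {1, 2} - min_error \<rho> {1, 3} - min_error \<rho> {2, 3}"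

end

theory Submission
  imports Defs
begin

text \<open>Write \<open>D\<close> for the three-state success and \<open>1 + \<tau>\<^sub>i\<^sub>j\<close> for the pairwise ones, so that
  \<open>\<beta> = 3 s - D\<close> with \<open>3 s\<close> the sum of the \<open>\<tau>\<^sub>i\<^sub>j\<close>. Two lower bounds on \<open>D\<close> meet at \<open>s = sqrt 15 / 4\<close>.

  Let \<open>X, Y, Z\<close> be the optimal pairwise effects in cyclic order and \<open>B\<^sub>1 = X - Z\<close>, \<open>B\<^sub>2 = Y - X\<close>,
  \<open>B\<^sub>3 = Z - Y\<close>. As \<open>X\<^sup>2 \<le> X\<close> etc., the sum of the \<open>B\<^sub>i\<^sup>2\<close> is at most \<open>3 Q - Q\<^sup>2 \<le> 9/4\<close> for \<open>Q = X + Y + Z\<close>.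
  The measurement proportional to \<open>(1 + r B\<^sub>i)\<^sup>2\<close> with \<open>r = 4 s / 3\<close> then gives \<open>D \<ge> 1 + 4 s\<^sup>2 / 3\<close>.

  The pretty good measurement has total error at most the sum of the pairwise fidelities
  (Barnum and Knill), and each fidelity \<open>f\<close> satisfies \<open>f\<^sup>2 + \<tau>\<^sup>2 \<le> 1\<close> (Fuchs and van de Graaf); the tangent
  of this circle at \<open>f = 1/4\<close> yields \<open>D \<ge> 3 sqrt 15 s - 9\<close>.\<close>

section \<open>Adjoints, traces and positive semidefinite matrices\<close>

definition dagger :: "complex^'n^'m \<Rightarrow> complex^'m^'n" where
  "dagger A = (\<chi> i j. cnj (A $ j $ i))"

text \<open>Bounded bilinearity yields all distributive, scaling and sum rules of the matrix
  product, collected below in \<open>matrix_ring\<close> and its companions.\<close>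

lemma bounded_bilinear_matrix_mult:
  "bounded_bilinear ((**) :: complex^'n^'m \<Rightarrow> complex^'k^'n \<Rightarrow> complex^'k^'m)"
  unfolding bilinear_conv_bounded_bilinear[symmetric] bilinear_def linear_iff
  by (simp add: matrix_matrix_mult_def vec_eq_iff algebra_simps sum.distrib scaleR_sum_right)

lemmas matrix_ring =
  bounded_bilinear.add_left[OF bounded_bilinear_matrix_mult]
  bounded_bilinear.add_right[OF bounded_bilinear_matrix_mult]
  bounded_bilinear.diff_left[OF bounded_bilinear_matrix_mult]
  bounded_bilinear.diff_right[OF bounded_bilinear_matrix_mult]
  bounded_bilinear.scaleR_left[OF bounded_bilinear_matrix_mult]
  bounded_bilinear.scaleR_right[OF bounded_bilinear_matrix_mult]
  bounded_bilinear.zero_left[OF bounded_bilinear_matrix_mult]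
  bounded_bilinear.zero_right[OF bounded_bilinear_matrix_mult]
  bounded_bilinear.minus_left[OF bounded_bilinear_matrix_mult]
  bounded_bilinear.minus_right[OF bounded_bilinear_matrix_mult]

lemmas matrix_sum_left = bounded_bilinear.sum_left[OF bounded_bilinear_matrix_mult]
lemmas matrix_sum_right = bounded_bilinear.sum_right[OF bounded_bilinear_matrix_mult]

lemma linear_dagger: "linear dagger"
  by (simp add: linear_iff dagger_def vec_eq_iff)

lemmas dagger_linear = linear_add[OF linear_dagger] linear_diff[OF linear_dagger]
  linear_scale[OF linear_dagger] linear_0[OF linear_dagger]

lemma dagger_dagger [simp]: "dagger (dagger A) = A"
  by (simp add: dagger_def vec_eq_iff)

lemma dagger_mult: "dagger (A ** B) = dagger B ** dagger A"
  by (simp add: dagger_def matrix_matrix_mult_def vec_eq_iff mult.commute)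

lemma dagger_mat_1 [simp]: "dagger (mat 1) = mat 1"
  by (simp add: dagger_def mat_def vec_eq_iff)

lemma hermitian_iff: "hermitian A \<longleftrightarrow> dagger A = A"
  unfolding hermitian_def dagger_def vec_eq_iff vec_lambda_beta by metis

lemma psd_hermitian: "psd A \<Longrightarrow> dagger A = A"
  by (simp add: psd_def hermitian_iff)

lemma cinner_adjoint: "cinner v (A *v w) = cinner (dagger A *v v) w"
proof -
  have "cinner v (A *v w) = (\<Sum>i\<in>UNIV. \<Sum>j\<in>UNIV. cnj (v $ i) * (A $ i $ j * w $ j))"
    by (simp add: cinner_def matrix_vector_mult_def sum_distrib_left)
  also have "\<dots> = (\<Sum>j\<in>UNIV. \<Sum>i\<in>UNIV. cnj (v $ i) * (A $ i $ j * w $ j))"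
    by (rule sum.swap)
  also have "\<dots> = cinner (dagger A *v v) w"
    by (simp add: cinner_def dagger_def matrix_vector_mult_def sum_distrib_right sum_distrib_left algebra_simps)
  finally show ?thesis .
qed

lemma Re_cinner: "Re (cinner v w) = inner v w"
  by (simp add: cinner_def inner_vec_def inner_complex_def)

lemma psd_iff_inner: "psd A \<longleftrightarrow> dagger A = A \<and> (\<forall>v. 0 \<le> inner v (A *v v))"
  by (simp add: psd_def hermitian_iff Re_cinner)

lemma inner_adjoint: "inner v (A *v w) = inner (dagger A *v v) w" for A :: "complex^'n^'n"
  by (metis Re_cinner cinner_adjoint)

lemma psd_congruence:
  fixes A C :: "complex^'n^'n"
  assumes "psd A"
  shows "psd (dagger C ** A ** C)"
proof -
  have "inner v ((dagger C ** A ** C) *v v) = inner (C *v v) (A *v (C *v v))" for v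
    by (simp add: matrix_vector_mul_assoc[symmetric] inner_adjoint[of v "dagger C"])
  then show ?thesis using assms
    by (simp add: psd_iff_inner dagger_mult matrix_mul_assoc)
qed

lemma psd_congruence': "psd A \<Longrightarrow> psd (C ** A ** dagger C)" for A C :: "complex^'n^'n"
  using psd_congruence[of A "dagger C"] by simp

lemma psd_mat_1: "psd (mat 1 :: complex^'n^'n)"
  by (simp add: psd_iff_inner)

lemma psd_dagger_mult: "psd (dagger C ** C)" for C :: "complex^'n^'n"
  using psd_congruence[OF psd_mat_1, of C] by simp

lemma psd_square: "dagger C = C \<Longrightarrow> psd (C ** C)" for C :: "complex^'n^'n"
  using psd_dagger_mult[of C] by simp

lemma psd_0: "psd (0 :: complex^'n^'n)"
  using psd_dagger_mult[of "0 :: complex^'n^'n"] by (simp add: matrix_ring)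

lemma psd_add: "psd A \<Longrightarrow> psd B \<Longrightarrow> psd (A + B)"
  by (auto simp: psd_iff_inner dagger_linear matrix_vector_mult_add_rdistrib inner_add_right
      intro!: add_nonneg_nonneg)

lemma scaleR_matrix_vector: "(c *\<^sub>R A) *v v = c *\<^sub>R (A *v v)" for A :: "complex^'n^'m"
  by (simp add: matrix_vector_mult_def vec_eq_iff scaleR_sum_right)

lemma psd_scaleR: "0 \<le> c \<Longrightarrow> psd A \<Longrightarrow> psd (c *\<^sub>R A)"
  by (auto simp: psd_iff_inner dagger_linear scaleR_matrix_vector)

lemma psd_sum: "(\<And>i. i \<in> I \<Longrightarrow> psd (A i)) \<Longrightarrow> psd (\<Sum>i\<in>I. A i)"
  by (induction I rule: infinite_finite_induct) (auto intro: psd_add psd_0)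

lemma linear_Re_trace: "linear (\<lambda>A :: complex^'n^'n. Re (trace A))"
  by (simp add: linear_iff trace_def sum.distrib sum_distrib_left)

lemmas Re_trace_linear = linear_add[OF linear_Re_trace] linear_diff[OF linear_Re_trace]
  linear_scale[OF linear_Re_trace] linear_0[OF linear_Re_trace]

lemmas Re_trace_sum = linear_sum[OF linear_Re_trace]

text \<open>The Euclidean inner product of matrices is the real Hilbert-Schmidt product, so
  Cauchy-Schwarz and norm estimates apply to traces.\<close>

lemma inner_matrix: "inner A B = Re (trace (dagger A ** B))" for A B :: "complex^'n^'n"
proof -
  have "inner A B = (\<Sum>i\<in>UNIV. \<Sum>j\<in>UNIV. Re (cnj (A $ i $ j) * B $ i $ j))"
    by (simp add: inner_vec_def inner_complex_def)
  also have "\<dots> = (\<Sum>j\<in>UNIV. \<Sum>i\<in>UNIV. Re (cnj (A $ i $ j) * B $ i $ j))"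
    by (rule sum.swap)
  also have "\<dots> = Re (trace (dagger A ** B))"
    by (simp add: trace_def dagger_def matrix_matrix_mult_def)
  finally show ?thesis .
qed

lemma psd_trace_nonneg: "psd A \<Longrightarrow> 0 \<le> Re (trace A)"
  by (auto simp: trace_def intro!: sum_nonneg psd_diag)

section \<open>The spectral theorem\<close>

text \<open>The quadratic attains its minimum at \<open>t = 0\<close>, so its derivative there
  vanishes. This is the first-order condition for the Rayleigh quotient below.\<close>

lemma linear_coefficient_zero:
  fixes b c :: real
  assumes "\<And>t. 0 \<le> t * b + t\<^sup>2 * c"
  shows "b = 0"
proof (rule ccontr)
  assume b: "b \<noteq> 0"
  \<comment> \<open>For this \<open>t\<close> the quadratic with \<open>c\<close> replaced by its
    absolute value equals \<open>- t\<^sup>2\<close>.\<close>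
  define t where "t = - b / (\<bar>c\<bar> + 1)"
  have t: "t * (\<bar>c\<bar> + 1) = - b" by (simp add: t_def)
  have "0 \<le> t * b + t\<^sup>2 * \<bar>c\<bar>"
    using assms[of t] mult_left_mono[OF abs_ge_self[of c] zero_le_power2[of t]] by linarith
  also have "\<dots> = t * (b + t * \<bar>c\<bar>)" by (simp add: power2_eq_square algebra_simps)
  also have "b + t * \<bar>c\<bar> = - t" using t by (simp add: algebra_simps)
  finally have "t\<^sup>2 \<le> 0" by (simp add: power2_eq_square)
  then have "t = 0" by simp
  then show False using t b by simp
qed

lemma cinner_self: "cinner v v = of_real (inner v v)"
  by (simp add: cinner_def inner_vec_def inner_complex_def complex_eq_iff Re_sum Im_sum)

lemma cinner_commute: "cinner w v = cnj (cinner v w)"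
  by (simp add: cinner_def mult.commute)

lemma cinner_smult_left: "cinner (\<i> *s v) w = - \<i> * cinner v w"
  by (simp add: cinner_def vector_scalar_mult_def sum_distrib_left algebra_simps sum_negf)

text \<open>Orthogonality with respect to \<open>cinner\<close> is real orthogonality to both \<open>v\<close> and \<open>\<i> v\<close>;
  the real dimension of \<open>complex^'n\<close> is twice its complex one.\<close>

lemma cinner_orthogonal_exists:
  fixes v :: "'n \<Rightarrow> complex^'n"
  assumes "card F < CARD('n)"
  obtains w where "norm w = 1" "\<And>i. i \<in> F \<Longrightarrow> cinner (v i) w = 0"
proof -
  define S where "S = v ` F \<union> (\<lambda>i. \<i> *s v i) ` F"
  have "card S \<le> card F + card F" unfolding S_def
    by (rule order_trans[OF card_Un_le add_mono]) (auto intro: card_image_le)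
  moreover have "dim S \<le> card S" by (rule dim_le_card') (simp add: S_def)
  ultimately have "dim S < DIM(complex^'n)" using assms by simp
  then obtain x where x: "x \<noteq> 0" "\<And>y. y \<in> span S \<Longrightarrow> orthogonal x y"
    by (rule orthogonal_to_subspace_exists) (rule that)
  have "cinner (v i) x = 0" if "i \<in> F" for i
  proof -
    have "inner (v i) x = 0" "inner (\<i> *s v i) x = 0"
      using x(2)[OF span_base] that by (auto simp: S_def orthogonal_def inner_commute[of _ x])
    then have "Re (cinner (v i) x) = 0" "Re (- \<i> * cinner (v i) x) = 0"
      by (simp_all only: Re_cinner cinner_smult_left[symmetric])
    then show ?thesis by (simp add: complex_eq_iff)
  qed
  moreover have "cinner u (c *\<^sub>R w) = of_real c * cinner u w" for u w :: "complex^'n" and c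
    by (simp add: cinner_def sum_distrib_left scaleR_conv_of_real[where 'a = complex] algebra_simps)
  ultimately show ?thesis
    using x(1) by (intro that[of "(1 / norm x) *\<^sub>R x"]) auto
qed

text \<open>The complement \<open>W\<close> of the earlier eigenvectors is invariant under
  \<open>A\<close>, and its unit sphere is compact. A maximiser of the Rayleigh quotient there is an
  eigenvector.\<close>

lemma eigenvector_in_complement:
  fixes A :: "complex^'n^'n" and v :: "'n \<Rightarrow> complex^'n"
  assumes A: "dagger A = A" and F: "card F < CARD('n)"
    and eig: "\<And>i. i \<in> F \<Longrightarrow> A *v v i = d i *\<^sub>R v i"
  obtains w l where "norm w = 1" "\<And>i. i \<in> F \<Longrightarrow> cinner (v i) w = 0" "A *v w = l *\<^sub>R w"
proof -
  define W where "W = {w. \<forall>i\<in>F. cinner (v i) w = 0}"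
  have Wlin: "x + t *\<^sub>R y \<in> W" if "x \<in> W" "y \<in> W" for x y t
  proof -
    have "cinner u (x + t *\<^sub>R y) = cinner u x + of_real t * cinner u y" for u
      by (simp add: cinner_def sum_distrib_left sum.distrib scaleR_conv_of_real[where 'a = complex] algebra_simps)
    then show ?thesis using that by (simp add: W_def)
  qed
  have AW: "A *v x \<in> W" if "x \<in> W" for x
  proof -
    have "cinner (v i) (A *v x) = of_real (d i) * cinner (v i) x" if "i \<in> F" for i
      using eig[OF that]
      by (simp add: cinner_adjoint A) (simp add: cinner_def sum_distrib_left scaleR_conv_of_real[where 'a = complex] algebra_simps)
    then show ?thesis using that by (simp add: W_def)
  qed
  have clW: "closed W" unfolding W_def cinner_def Ball_def
    by (intro closed_Collect_all closed_Collect_imp open_Collect_const closed_Collect_eq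
        continuous_intros)
  have comp: "compact (sphere 0 1 \<inter> W)" by (intro compact_Int_closed clW) simp
  obtain w0 where "norm w0 = 1" "\<And>i. i \<in> F \<Longrightarrow> cinner (v i) w0 = 0"
    using cinner_orthogonal_exists[OF F] by blast
  then have ne: "sphere 0 1 \<inter> W \<noteq> {}" by (auto simp: W_def)
  have "continuous_on (sphere 0 1 \<inter> W) (\<lambda>w. inner w (A *v w))"
    by (intro continuous_intros linear_continuous_on linear_conv_bounded_linear[THEN iffD1]) auto
  from continuous_attains_sup[OF comp ne this] obtain w
    where w: "norm w = 1" "w \<in> W" and max: "\<And>y. norm y = 1 \<Longrightarrow> y \<in> W \<Longrightarrow> inner y (A *v y) \<le> inner w (A *v w)"
    by auto
  define l where "l = inner w (A *v w)"
  \<comment> \<open>As \<open>l\<close> is the maximal Rayleigh quotient, this form is nonnegative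
    on \<open>W\<close>, and it vanishes at \<open>w\<close>.\<close>
  define q where "q = (\<lambda>y. l * inner y y - inner y (A *v y))"
  have Alin: "A *v (x + t *\<^sub>R y) = A *v x + t *\<^sub>R (A *v y)" for x y t
    using matrix_vector_mul_linear[of A] by (simp add: linear_add linear_scale)
  have q: "0 \<le> q y" if "y \<in> W" for y
  proof (cases "y = 0")
    case False
    have "(1 / norm y) *\<^sub>R y \<in> W" using Wlin[of 0 y "1 / norm y"] that by (simp add: W_def cinner_def)
    then have "inner ((1 / norm y) *\<^sub>R y) (A *v ((1 / norm y) *\<^sub>R y)) \<le> l"
      unfolding l_def using False by (intro max) auto
    moreover have "A *v ((1 / norm y) *\<^sub>R y) = (1 / norm y) *\<^sub>R (A *v y)"
      using Alin[of 0 "1 / norm y" y] by simp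
    ultimately have "inner y (A *v y) / (norm y)\<^sup>2 \<le> l" by (simp add: power2_eq_square)
    then show ?thesis using False
      by (simp add: q_def dot_square_norm divide_le_eq)
  qed (simp add: q_def)
  have ww: "inner w w = 1" using w(1) by (simp add: dot_square_norm)
  have sym: "inner x (A *v y) = inner y (A *v x)" for x y
    by (metis A inner_adjoint inner_commute)
  have orth: "inner u (l *\<^sub>R w - A *v w) = 0" if "u \<in> W" for u
  proof -
    have "q (w + t *\<^sub>R u) = t * (2 * inner u (l *\<^sub>R w - A *v w)) + t\<^sup>2 * q u" for t
      using sym[of w u] ww Alin[of 0 t u]
      by (simp add: q_def inner_add inner_diff inner_commute[of w u] l_def
          power2_eq_square matrix_vector_right_distrib algebra_simps)
    then have "0 \<le> t * (2 * inner u (l *\<^sub>R w - A *v w)) + t\<^sup>2 * q u" for t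
      by (metis Wlin that w(2) q)
    then have "2 * inner u (l *\<^sub>R w - A *v w) = 0" by (rule linear_coefficient_zero)
    then show ?thesis by simp
  qed
  \<comment> \<open>The residual itself lies in \<open>W\<close>, so it is orthogonal to
    itself.\<close>
  have "A *v w + (- l) *\<^sub>R w \<in> W" using Wlin AW w(2) by blast
  from orth[OF this] have "inner (A *v w - l *\<^sub>R w) (A *v w - l *\<^sub>R w) = 0"
    by (simp add: inner_diff)
  then have "A *v w = l *\<^sub>R w" by simp
  then show ?thesis using that[of w l] w by (simp add: W_def)
qed

text \<open>Induction on \<open>F\<close> adds one eigenvector at a time. Indexing by the coordinate
  type leaves a nonzero complement until \<open>F\<close> is all of it.\<close>

lemma orthonormal_eigenvectors:
  fixes A :: "complex^'n^'n"
  assumes "dagger A = A"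
  shows "\<exists>(v :: 'n \<Rightarrow> complex^'n) d. (\<forall>i\<in>F. \<forall>j\<in>F. cinner (v i) (v j) = (if i = j then 1 else 0)) \<and>
    (\<forall>i\<in>F. A *v v i = d i *\<^sub>R v i)"
proof (induction F rule: infinite_finite_induct)
  case (insert x F)
  then obtain v :: "'n \<Rightarrow> complex^'n" and d where
    vd: "\<forall>i\<in>F. \<forall>j\<in>F. cinner (v i) (v j) = (if i = j then 1 else 0)" "\<forall>i\<in>F. A *v v i = d i *\<^sub>R v i"
    by blast
  have "card F < CARD('n)"
    using insert psubset_card_mono[of UNIV F] by auto
  from eigenvector_in_complement[OF assms this, of v d] vd(2) obtain w l where
    w: "norm w = 1" "\<And>i. i \<in> F \<Longrightarrow> cinner (v i) w = 0" "A *v w = l *\<^sub>R w" by blast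
  have "cinner w w = 1" using w(1) by (simp add: cinner_self dot_square_norm)
  moreover have "cinner w (v i) = 0" if "i \<in> F" for i
    using w(2)[OF that] cinner_commute[of w "v i"] by simp
  ultimately show ?case
    using insert.hyps vd w(2,3) by (intro exI[of _ "v(x := w)"] exI[of _ "d(x := l)"]) auto
qed auto

definition diag_mat :: "('n \<Rightarrow> real) \<Rightarrow> complex^'n^'n" where
  "diag_mat d = (\<chi> i j. if i = j then of_real (d i) else 0)"

lemma diag_mat_mult: "diag_mat d ** diag_mat e = diag_mat (\<lambda>i. d i * e i)"
  by (simp add: diag_mat_def matrix_matrix_mult_def vec_eq_iff if_distrib[of "\<lambda>x. x * _"] cong: if_cong)

lemma dagger_diag_mat: "dagger (diag_mat d) = diag_mat d"
  by (simp add: diag_mat_def dagger_def vec_eq_iff if_distrib[of cnj] cong: if_cong)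

lemma spectral_theorem:
  fixes A :: "complex^'n^'n"
  assumes "dagger A = A"
  obtains U :: "complex^'n^'n" and d where "dagger U ** U = mat 1" "U ** dagger U = mat 1" "A = U ** diag_mat d ** dagger U"
proof -
  obtain v :: "'n \<Rightarrow> complex^'n" and d where
    vd: "\<And>i j. cinner (v i) (v j) = (if i = j then 1 else 0)" "\<And>i. A *v v i = d i *\<^sub>R v i"
    using orthonormal_eigenvectors[OF assms, of UNIV] by auto
  define U where "U = (\<chi> i k. v k $ i)"
  have 1: "dagger U ** U = mat 1"
    using vd(1) by (simp add: vec_eq_iff U_def dagger_def matrix_matrix_mult_def mat_def cinner_def)
  then have 2: "U ** dagger U = mat 1" by (simp add: matrix_left_right_inverse)
  have "(A ** U) $ i $ k = (U ** diag_mat d) $ i $ k" for i k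
  proof -
    have "(A ** U) $ i $ k = (A *v v k) $ i"
      by (simp add: U_def matrix_matrix_mult_def matrix_vector_mult_def)
    also have "\<dots> = (U ** diag_mat d) $ i $ k"
      by (simp add: vd(2) U_def matrix_matrix_mult_def diag_mat_def scaleR_conv_of_real[where 'a = complex]
          if_distrib[of "\<lambda>x. _ * x"] mult.commute cong: if_cong)
    finally show ?thesis .
  qed
  then have "A ** U = U ** diag_mat d" by (simp add: vec_eq_iff)
  then have "A = U ** diag_mat d ** dagger U"
    by (metis 2 matrix_mul_assoc matrix_mul_rid)
  with 1 2 show ?thesis by (rule that)
qed

section \<open>Functional calculus: square roots, pseudoinverses, polar decomposition\<close>

lemma diag_conjugate_mult:
  assumes "dagger U ** U = mat 1"
  shows "(U ** diag_mat d ** dagger U) ** (U ** diag_mat e ** dagger U) =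
    U ** diag_mat (\<lambda>i. d i * e i) ** dagger U"
proof -
  have "(U ** diag_mat d ** dagger U) ** (U ** diag_mat e ** dagger U) =
      U ** diag_mat d ** (dagger U ** U) ** diag_mat e ** dagger U"
    by (simp only: matrix_mul_assoc)
  then show ?thesis by (simp add: assms diag_mat_mult[symmetric] matrix_mul_assoc)
qed

lemma diag_mat_psd:
  assumes "\<And>i. 0 \<le> d i"
  shows "psd (diag_mat d)"
  using psd_square[OF dagger_diag_mat, of "\<lambda>i. sqrt (d i)"] assms
  by (simp add: diag_mat_mult)

text \<open>\<open>P\<close> is the square root of \<open>S\<close> and \<open>N\<close> the
  Moore-Penrose inverse of \<open>P\<close>. Both are diagonal in an eigenbasis of
  \<open>S\<close>.\<close>

lemma psd_sqrt_pseudoinverse: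
  fixes S :: "complex^'n^'n"
  assumes "psd S"
  obtains P N where "psd P" "dagger N = N" "P ** P = S" "N ** P = P ** N" "P ** N ** P = P"
proof -
  obtain U :: "complex^'n^'n" and d where
    U: "dagger U ** U = mat 1" "U ** dagger U = mat 1" "S = U ** diag_mat d ** dagger U"
    using spectral_theorem[OF psd_hermitian[OF assms]] by blast
  have "diag_mat d = (dagger U ** U) ** diag_mat d ** (dagger U ** U)"
    by (simp add: U(1))
  also have "\<dots> = dagger U ** S ** U"
    by (simp only: U(3) matrix_mul_assoc)
  finally have "psd (diag_mat d)" using psd_congruence[OF assms] by simp
  then have d: "0 \<le> d i" for i
    using psd_diag[of "diag_mat d" i] by (simp add: diag_mat_def)
  define P where "P = U ** diag_mat (\<lambda>i. sqrt (d i)) ** dagger U"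
  \<comment> \<open>The convention \<open>inverse 0 = 0\<close> makes \<open>N\<close> vanish on the
    kernel of \<open>S\<close>.\<close>
  define N where "N = U ** diag_mat (\<lambda>i. inverse (sqrt (d i))) ** dagger U"
  have "psd P" unfolding P_def by (intro psd_congruence' diag_mat_psd) (simp add: d)
  moreover have "dagger N = N" by (simp add: N_def dagger_mult dagger_diag_mat matrix_mul_assoc)
  moreover have "P ** P = S" "N ** P = P ** N"
    by (simp_all add: P_def N_def diag_conjugate_mult[OF U(1)] U(3) d mult.commute)
  moreover have "sqrt (d i) * inverse (sqrt (d i)) * sqrt (d i) = sqrt (d i)" for i
    by (cases "d i = 0") simp_all
  then have "P ** N ** P = P" unfolding P_def N_def diag_conjugate_mult[OF U(1)] by presburger
  ultimately show ?thesis by (rule that)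
qed

text \<open>By cyclicity the trace is that of \<open>A\<close> conjugated by the square root of
  \<open>B\<close>.\<close>

lemma Re_trace_mult_nonneg:
  fixes A B :: "complex^'n^'n"
  assumes "psd A" "psd B"
  shows "0 \<le> Re (trace (A ** B))"
proof -
  obtain P where P: "psd P" "P ** P = B" using psd_sqrt_pseudoinverse[OF assms(2)] by blast
  have "trace (A ** B) = trace (P ** A ** P)"
    using trace_mul_sym[of "A ** P" P] by (simp add: P(2)[symmetric] matrix_mul_assoc)
  moreover have "psd (P ** A ** P)"
    using psd_congruence[OF assms(1), of P] by (simp add: psd_hermitian[OF P(1)])
  ultimately show ?thesis by (simp add: psd_trace_nonneg)
qed

text \<open>A polar decomposition of the block column with entries \<open>A i\<close>; \<open>Q\<close> is the projection onto
  the range of \<open>P\<close>.\<close>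

lemma polar_family:
  fixes A :: "'i \<Rightarrow> complex^'n^'n"
  assumes I: "finite I"
  obtains P X Q where "psd P" "P ** P = (\<Sum>i\<in>I. dagger (A i) ** A i)"
    "\<And>i. i \<in> I \<Longrightarrow> A i = X i ** P" "Q = (\<Sum>i\<in>I. dagger (X i) ** X i)"
    "psd (mat 1 - Q)" "Q ** P = P" "P ** Q = P"
proof -
  define S where "S = (\<Sum>i\<in>I. dagger (A i) ** A i)"
  have "psd S" unfolding S_def by (intro psd_sum psd_dagger_mult)
  then obtain P N where PN: "psd P" "dagger N = N" "P ** P = S" "N ** P = P ** N" "P ** N ** P = P"
    by (rule psd_sqrt_pseudoinverse)
  have P: "dagger P = P" by (rule psd_hermitian[OF PN(1)])
  define Q where "Q = P ** N"
  have "P ** Q = P ** N ** P"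
    by (simp only: Q_def PN(4)[symmetric] matrix_mul_assoc)
  moreover have "Q ** Q = (P ** N ** P) ** N"
    by (simp only: Q_def matrix_mul_assoc)
  ultimately have Q: "dagger Q = Q" "Q ** P = P" "Q ** Q = Q" "P ** Q = P" "Q = N ** P"
    by (simp_all add: PN(5)) (simp_all add: Q_def dagger_mult P PN)
  \<comment> \<open>Each \<open>A i\<close> vanishes on the kernel of \<open>P\<close>: the squared
    norms of the defects add up to the trace of \<open>(mat 1 - Q) ** S ** (mat 1 - Q)\<close>,
    which is zero because \<open>P ** Q = P\<close>.\<close>
  have "A i - A i ** Q = 0" if "i \<in> I" for i
  proof -
    have "(\<Sum>i\<in>I. inner (A i - A i ** Q) (A i - A i ** Q)) =
        Re (trace (\<Sum>i\<in>I. dagger (A i - A i ** Q) ** (A i - A i ** Q)))"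
      by (simp add: inner_matrix Re_trace_sum)
    also have "(\<Sum>i\<in>I. dagger (A i - A i ** Q) ** (A i - A i ** Q)) =
        (\<Sum>i\<in>I. (mat 1 - Q) ** (dagger (A i) ** A i) ** (mat 1 - Q))"
      by (intro sum.cong) (simp_all add: dagger_linear dagger_mult Q(1) matrix_ring matrix_mul_assoc)
    also have "\<dots> = (mat 1 - Q) ** S ** (mat 1 - Q)"
      by (simp add: S_def matrix_sum_left matrix_sum_right)
    also have "\<dots> = 0"
    proof -
      have "S ** (mat 1 - Q) = 0"
        by (simp add: PN(3)[symmetric] matrix_ring matrix_mul_assoc[symmetric] Q(4))
      then show ?thesis by (simp add: matrix_mul_assoc[symmetric] matrix_ring)
    qed
    finally have "(\<Sum>i\<in>I. inner (A i - A i ** Q) (A i - A i ** Q)) = 0"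
      by (simp add: Re_trace_linear)
    then show ?thesis using that I by (simp add: sum_nonneg_eq_0_iff)
  qed
  then have A: "A i = (A i ** N) ** P" if "i \<in> I" for i
    using that by (simp add: Q(5) matrix_mul_assoc)
  have "(\<Sum>i\<in>I. dagger (A i ** N) ** (A i ** N)) = N ** S ** N"
    by (simp add: S_def matrix_sum_left matrix_sum_right dagger_mult PN(2) matrix_mul_assoc)
  also have "\<dots> = Q ** Q"
    by (subst Q(5), subst (1) Q_def) (simp add: PN(3)[symmetric] matrix_mul_assoc)
  finally have S: "Q = (\<Sum>i\<in>I. dagger (A i ** N) ** (A i ** N))" by (simp add: Q(3))
  have "psd ((mat 1 - Q) ** (mat 1 - Q))" by (rule psd_square) (simp add: dagger_linear Q(1))
  then have "psd (mat 1 - Q)" by (simp add: matrix_ring Q(3))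
  from that[OF PN(1) PN(3)[unfolded S_def] A S this Q(2,4)] show ?thesis .
qed

section \<open>The pretty good measurement\<close>

text \<open>The matrices \<open>X i ** P ** dagger (X j)\<close> are the blocks of the square root of the Gram
  matrix with blocks \<open>dagger (L i) ** L j\<close>, where \<open>L i = P ** dagger (X i)\<close>. The contraction with
  blocks \<open>W j\<close> comes from the polar decomposition of the off-diagonal part of row \<open>i\<close>.\<close>

lemma gram_sqrt_row_bound:
  fixes X :: "'i \<Rightarrow> complex^'n^'n"
  assumes J: "finite J" "i \<notin> J" and P: "psd P"
    and Q: "P ** (dagger (X i) ** X i + (\<Sum>j\<in>J. dagger (X j) ** X j)) ** P = P ** P"
  obtains W where "\<And>j. j \<in> J \<Longrightarrow> psd (mat 1 - W j ** dagger (W j))"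
    "2 * (\<Sum>j\<in>J. Re (trace ((X i ** P ** dagger (X j)) ** dagger (X i ** P ** dagger (X j))))) \<le>
      (\<Sum>j\<in>J. Re (trace (P ** dagger (X i) ** W j ** dagger (P ** dagger (X j)))))"
proof -
  \<comment> \<open>\<open>R j\<close> is block \<open>(i, j)\<close> of the Gram square root. The
    polar decomposition factors the off-diagonal row as \<open>R j = H ** W j\<close>.\<close>
  define R where "R j = X i ** P ** dagger (X j)" for j
  obtain H Y C where H: "psd H" "H ** H = (\<Sum>j\<in>J. dagger (dagger (R j)) ** dagger (R j))"
    "\<And>j. j \<in> J \<Longrightarrow> dagger (R j) = Y j ** H" "C = (\<Sum>j\<in>J. dagger (Y j) ** Y j)"
    "psd (mat 1 - C)" "C ** H = H" "H ** C = H"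
    by (rule polar_family[OF J(1), where A = "\<lambda>j. dagger (R j)"]) (rule that)
  define W where "W j = dagger (Y j)" for j
  note dP = psd_hermitian[OF P] and dH = psd_hermitian[OF H(1)]
  have R: "R j = H ** W j" if "j \<in> J" for j
    using arg_cong[OF H(3)[OF that], of dagger] by (simp add: W_def dagger_mult dH)
  \<comment> \<open>Combining the \<open>X j\<close> with weights \<open>W j\<close> gathers the row
    into a single block: \<open>X i ** P ** dagger V = H\<close>.\<close>
  define V where "V = (\<Sum>j\<in>J. W j ** X j)"
  have dV: "dagger V = (\<Sum>j\<in>J. dagger (X j) ** dagger (W j))"
    by (simp add: V_def linear_sum[OF linear_dagger] dagger_mult)
  have "X i ** P ** dagger V = (\<Sum>j\<in>J. R j ** dagger (W j))"
    by (simp add: dV matrix_sum_right R_def matrix_mul_assoc)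
  also have "\<dots> = (\<Sum>j\<in>J. H ** (W j ** dagger (W j)))"
    by (intro sum.cong) (simp_all add: R matrix_mul_assoc)
  also have "\<dots> = H" by (simp add: matrix_sum_right[symmetric] W_def H(4)[symmetric] H(7))
  finally have XV: "X i ** P ** dagger V = H" .
  from arg_cong[OF this, of dagger] have VX: "V ** P ** dagger (X i) = H"
    by (simp add: dagger_mult dP dH matrix_mul_assoc)
  \<comment> \<open>\<open>W j ** dagger (W j)\<close> is one of the positive summands of
    \<open>C\<close>, which is at most the identity.\<close>
  have contr: "psd (mat 1 - W j ** dagger (W j))" if "j \<in> J" for j
  proof -
    have "C = dagger (Y j) ** Y j + (\<Sum>k\<in>J - {j}. dagger (Y k) ** Y k)"
      using J(1) that by (simp add: H(4) sum.remove)
    then have "mat 1 - W j ** dagger (W j) = (mat 1 - C) + (\<Sum>k\<in>J - {j}. dagger (Y k) ** Y k)"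
      by (simp add: W_def)
    then show ?thesis by (simp only: psd_add H(5) psd_sum psd_dagger_mult)
  qed
  \<comment> \<open>Both cross terms of this form equal \<open>H\<close>. Tracing against
    \<open>H\<close> bounds \<open>2 * Re (trace (H ** H))\<close>, twice the off-diagonal weight of
    the row, by the two diagonal terms.\<close>
  have "psd ((X i - V) ** P ** dagger (X i - V))" by (rule psd_congruence'[OF P])
  also have "(X i - V) ** P ** dagger (X i - V) =
      (X i ** P ** dagger (X i) + V ** P ** dagger V) - 2 *\<^sub>R H"
    by (simp add: dagger_linear matrix_ring XV VX scaleR_2 algebra_simps)
  finally have "0 \<le> Re (trace (((X i ** P ** dagger (X i) + V ** P ** dagger V) - 2 *\<^sub>R H) ** H))"
    using Re_trace_mult_nonneg H(1) by blast
  then have "2 * Re (trace (H ** H)) \<le> Re (trace ((X i ** P ** dagger (X i) + V ** P ** dagger V) ** H))"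
    by (simp add: matrix_ring Re_trace_linear)
  also have "(X i ** P ** dagger (X i) + V ** P ** dagger V) ** H =
      X i ** P ** dagger (X i) ** H + V ** P ** dagger V ** H"
    by (simp add: matrix_ring)
  also have "Re (trace \<dots>) =
      Re (trace (H ** (X i ** P ** dagger (X i)))) + Re (trace (V ** P ** dagger V ** H))"
    by (simp add: Re_trace_linear trace_mul_sym[of H])
  \<comment> \<open>Substituting for \<open>H\<close> here and for \<open>dagger (W j) ** H\<close>
    below places each \<open>dagger (X k) ** X k\<close> between two copies of \<open>P\<close>,
    where the hypothesis sums them to \<open>P ** P\<close>.\<close>
  also have "H ** (X i ** P ** dagger (X i)) = V ** P ** (dagger (X i) ** X i) ** P ** dagger (X i)"
    by (simp add: VX[symmetric] matrix_mul_assoc)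
  also have "V ** P ** dagger V ** H = (\<Sum>j\<in>J. V ** P ** (dagger (X j) ** (dagger (W j) ** H)))"
    by (simp add: dV matrix_sum_right matrix_sum_left matrix_mul_assoc)
  also have "\<dots> = (\<Sum>j\<in>J. V ** P ** (dagger (X j) ** X j) ** P ** dagger (X i))"
  proof (intro sum.cong refl)
    fix j assume "j \<in> J"
    from arg_cong[OF R[OF this], of dagger]
    have "dagger (W j) ** H = X j ** P ** dagger (X i)"
      by (simp add: R_def dagger_mult dP dH matrix_mul_assoc)
    then show "V ** P ** (dagger (X j) ** (dagger (W j) ** H)) =
        V ** P ** (dagger (X j) ** X j) ** P ** dagger (X i)"
      by (simp add: matrix_mul_assoc)
  qed
  also have "Re (trace (V ** P ** (dagger (X i) ** X i) ** P ** dagger (X i))) + Re (trace \<dots>) =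
      Re (trace (V ** (P ** (dagger (X i) ** X i + (\<Sum>j\<in>J. dagger (X j) ** X j)) ** P) ** dagger (X i)))"
    by (simp add: matrix_ring matrix_sum_right matrix_sum_left Re_trace_linear matrix_mul_assoc)
  also have "V ** (P ** (dagger (X i) ** X i + (\<Sum>j\<in>J. dagger (X j) ** X j)) ** P) ** dagger (X i) =
      V ** (P ** P) ** dagger (X i)"
    by (simp only: Q)
  also have "trace \<dots> = trace ((P ** dagger (X i)) ** (V ** P))"
    by (subst trace_mul_sym[of "P ** dagger (X i)"]) (simp add: matrix_mul_assoc)
  also have "(P ** dagger (X i)) ** (V ** P) = (\<Sum>j\<in>J. P ** dagger (X i) ** W j ** dagger (P ** dagger (X j)))"
    by (simp add: V_def matrix_sum_left matrix_sum_right dagger_mult dP matrix_mul_assoc)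
  finally have "2 * Re (trace (H ** H)) \<le> (\<Sum>j\<in>J. Re (trace (P ** dagger (X i) ** W j ** dagger (P ** dagger (X j)))))"
    by (simp add: Re_trace_sum)
  then show ?thesis using contr by (intro that[of W]) (simp_all add: H(2) Re_trace_sum R_def)
qed

text \<open>\<open>F\<close> bounds the fidelities in variational form, as suprema over contractions
  \<open>W\<close>. The right side sums over ordered pairs, which accounts for the factor 2 on the
  left.\<close>

lemma pretty_good_measurement:
  fixes \<rho> :: "nat \<Rightarrow> complex^'n^'n"
  assumes H: "finite H" "H \<noteq> {}" and pos: "\<And>i. i \<in> H \<Longrightarrow> psd (\<rho> i)"
    and F: "\<And>i j (L :: complex^'n^'n) (K :: complex^'n^'n) W. i \<in> H \<Longrightarrow> j \<in> H \<Longrightarrow> i \<noteq> j \<Longrightarrow> \<rho> i = L ** dagger L \<Longrightarrow> \<rho> j = K ** dagger K \<Longrightarrow>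
      psd (mat 1 - W ** dagger W) \<Longrightarrow> Re (trace (L ** W ** dagger K)) \<le> F i j"
  obtains M where "povm H M"
    "2 * ((\<Sum>i\<in>H. Re (trace (\<rho> i))) - score \<rho> H M) \<le> (\<Sum>i\<in>H. \<Sum>j\<in>H - {i}. F i j)"
proof -
  have "\<exists>L :: complex^'n^'n. \<rho> i = L ** dagger L" if i: "i \<in> H" for i
  proof -
    obtain P where "psd P" "P ** P = \<rho> i" using psd_sqrt_pseudoinverse[OF pos[OF i]] by blast
    then show ?thesis using psd_hermitian[of P] by metis
  qed
  then obtain L :: "nat \<Rightarrow> complex^'n^'n" where L: "\<And>i. i \<in> H \<Longrightarrow> \<rho> i = L i ** dagger (L i)" by metis
  obtain P X Q where P: "psd P" "P ** P = (\<Sum>i\<in>H. dagger (dagger (L i)) ** dagger (L i))"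
    "\<And>i. i \<in> H \<Longrightarrow> dagger (L i) = X i ** P" "Q = (\<Sum>i\<in>H. dagger (X i) ** X i)"
    "psd (mat 1 - Q)" "Q ** P = P" "P ** Q = P"
    by (rule polar_family[OF H(1), where A = "\<lambda>i. dagger (L i)"]) (rule that)
  note dP = psd_hermitian[OF P(1)]
  have Li: "L i = P ** dagger (X i)" if "i \<in> H" for i
    using arg_cong[OF P(3)[OF that], of dagger] by (simp add: dagger_mult dP)
  \<comment> \<open>\<open>e i j\<close> is the squared norm of a block of the Gram square root, and
    also the probability of answering \<open>j\<close> on state \<open>i\<close>. This links the
    measurement to \<open>gram_sqrt_row_bound\<close>.\<close>
  define e where "e i j = Re (trace ((X i ** P ** dagger (X j)) ** dagger (X i ** P ** dagger (X j))))" for i j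
  have e: "Re (trace (\<rho> i ** (dagger (X j) ** X j))) = e i j" if "i \<in> H" for i j
  proof -
    have "\<rho> i ** (dagger (X j) ** X j) = (P ** dagger (X i)) ** (X i ** P ** dagger (X j) ** X j)"
      by (simp add: L[OF that] Li[OF that] dagger_mult dP matrix_mul_assoc)
    then have "trace (\<rho> i ** (dagger (X j) ** X j)) =
        trace ((X i ** P ** dagger (X j) ** X j) ** (P ** dagger (X i)))"
      by (simp only: trace_mul_sym[of "P ** dagger (X i)"])
    then show ?thesis by (simp add: e_def dagger_mult dP matrix_mul_assoc)
  qed
  obtain k where k: "k \<in> H" using H(2) by blast
  \<comment> \<open>Since \<open>P ** (dagger (X i) ** X i) ** P\<close> is \<open>\<rho> i\<close>,
    these are the pretty good effects on the range of \<open>P\<close>. The remainder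
    \<open>mat 1 - Q\<close> goes to one outcome, where it cannot lower the score.\<close>
  define M where "M i = dagger (X i) ** X i + (if i = k then mat 1 - Q else 0)" for i
  have "povm H M"
    using H(1) k by (auto simp: povm_def M_def P(4,5) sum.distrib intro!: psd_add psd_dagger_mult psd_0)
      (use P(4,5) in simp)
  have "(\<Sum>i\<in>H. e i i) \<le> score \<rho> H M"
    unfolding score_def
  proof (rule sum_mono)
    fix i assume i: "i \<in> H"
    have "0 \<le> Re (trace (\<rho> i ** (if i = k then mat 1 - Q else 0)))"
      using Re_trace_mult_nonneg[OF pos[OF i] P(5)] by (cases "i = k") (simp_all add: matrix_ring Re_trace_linear)
    then show "e i i \<le> Re (trace (\<rho> i ** M i))"
      by (simp add: M_def e[OF i, symmetric] bounded_bilinear.add_right[OF bounded_bilinear_matrix_mult] Re_trace_linear)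
  qed
  \<comment> \<open>No probability is lost to the remainder: \<open>P ** Q = P\<close> says that the
    states live on the range of \<open>Q\<close>.\<close>
  moreover have "Re (trace (\<rho> i)) = e i i + (\<Sum>j\<in>H - {i}. e i j)" if i: "i \<in> H" for i
  proof -
    have "Re (trace (\<rho> i)) = Re (trace (P ** (dagger (X i) ** X i ** P)))"
      by (simp add: L[OF i] Li[OF i] dagger_mult dP matrix_mul_assoc)
    also have "\<dots> = Re (trace (dagger (X i) ** X i ** (P ** Q ** P)))"
      by (subst trace_mul_sym[of P]) (simp add: P(7) matrix_mul_assoc)
    also have "trace (dagger (X i) ** X i ** (P ** Q ** P)) = trace (P ** (dagger (X i) ** X i ** P ** Q))"
      by (subst trace_mul_sym[of P]) (simp add: matrix_mul_assoc)
    also have "P ** (dagger (X i) ** X i ** P ** Q) = (\<Sum>j\<in>H. \<rho> i ** (dagger (X j) ** X j))"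
      by (simp add: P(4) L[OF i] Li[OF i] dagger_mult dP matrix_sum_right matrix_mul_assoc)
    finally have "Re (trace (\<rho> i)) = (\<Sum>j\<in>H. e i j)" by (simp add: Re_trace_sum e[OF i])
    then show ?thesis using H(1) i by (simp add: sum.remove)
  qed
  moreover have "2 * (\<Sum>j\<in>H - {i}. e i j) \<le> (\<Sum>j\<in>H - {i}. F i j)" if i: "i \<in> H" for i
  proof -
    have "dagger (X i) ** X i + (\<Sum>j\<in>H - {i}. dagger (X j) ** X j) = Q"
      using H(1) i by (simp add: P(4) sum.remove)
    then have PQP: "P ** (dagger (X i) ** X i + (\<Sum>j\<in>H - {i}. dagger (X j) ** X j)) ** P = P ** P"
      by (simp add: P(7))
    have J: "finite (H - {i})" "i \<notin> H - {i}" using H(1) by auto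
    obtain W where W: "\<And>j. j \<in> H - {i} \<Longrightarrow> psd (mat 1 - W j ** dagger (W j))"
      "2 * (\<Sum>j\<in>H - {i}. e i j) \<le>
        (\<Sum>j\<in>H - {i}. Re (trace (P ** dagger (X i) ** W j ** dagger (P ** dagger (X j)))))"
      by (rule gram_sqrt_row_bound[OF J P(1) PQP, folded e_def]) (rule that)
    note W(2)
    also have "(\<Sum>j\<in>H - {i}. Re (trace (P ** dagger (X i) ** W j ** dagger (P ** dagger (X j))))) \<le>
        (\<Sum>j\<in>H - {i}. F i j)"
    proof (rule sum_mono)
      fix j assume j: "j \<in> H - {i}"
      then show "Re (trace (P ** dagger (X i) ** W j ** dagger (P ** dagger (X j)))) \<le> F i j"
        using F[OF i, of j "L i" "L j" "W j"] W(1)[OF j] L i Li by auto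
    qed
    finally show ?thesis .
  qed
  ultimately have "2 * ((\<Sum>i\<in>H. Re (trace (\<rho> i))) - score \<rho> H M) \<le> (\<Sum>i\<in>H. \<Sum>j\<in>H - {i}. F i j)"
  proof -
    assume s: "(\<Sum>i\<in>H. e i i) \<le> score \<rho> H M"
      and t: "\<And>i. i \<in> H \<Longrightarrow> Re (trace (\<rho> i)) = e i i + (\<Sum>j\<in>H - {i}. e i j)"
      and b: "\<And>i. i \<in> H \<Longrightarrow> 2 * (\<Sum>j\<in>H - {i}. e i j) \<le> (\<Sum>j\<in>H - {i}. F i j)"
    have "(\<Sum>i\<in>H. Re (trace (\<rho> i))) = (\<Sum>i\<in>H. e i i) + (\<Sum>i\<in>H. \<Sum>j\<in>H - {i}. e i j)"
      by (simp add: t sum.distrib)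
    moreover have "2 * (\<Sum>i\<in>H. \<Sum>j\<in>H - {i}. e i j) \<le> (\<Sum>i\<in>H. \<Sum>j\<in>H - {i}. F i j)"
      unfolding sum_distrib_left by (rule sum_mono) (use b in \<open>simp add: sum_distrib_left\<close>)
    ultimately show ?thesis using s by simp
  qed
  with \<open>povm H M\<close> show ?thesis by (rule that)
qed

section \<open>Pairwise discrimination and fidelity\<close>

text \<open>The operator form of \<open>x\<^sup>2 \<le> x\<close> on the unit interval, by a sum of
  two congruences.\<close>

lemma effect_minus_square_psd:
  fixes E :: "complex^'n^'n"
  assumes "psd E" "psd (mat 1 - E)"
  shows "psd (E - E ** E)"
proof -
  have d: "dagger E = E" "dagger (mat 1 - E) = mat 1 - E"
    using assms by (simp_all add: psd_hermitian)
  have "E - E ** E = E ** (mat 1 - E) ** E + (mat 1 - E) ** E ** (mat 1 - E)"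
    by (simp add: matrix_ring matrix_mul_assoc)
  then show ?thesis
    using psd_add[OF psd_congruence[OF assms(2), of E] psd_congruence[OF assms(1), of "mat 1 - E"]]
    by (simp add: d)
qed

text \<open>The Fuchs-van de Graaf inequality for the variational fidelity. Replacing
  \<open>L\<close> by \<open>a = L ** W\<close> loses a positive part of trace \<open>c\<close>;
  what is left is a difference of squares, to which Cauchy-Schwarz applies.\<close>

lemma effect_difference_fidelity:
  fixes L K W E :: "complex^'n^'n"
  assumes tr: "Re (trace (L ** dagger L)) = 1" "Re (trace (K ** dagger K)) = 1"
    and W: "psd (mat 1 - W ** dagger W)" and E: "psd E" "psd (mat 1 - E)"
  shows "(Re (trace (L ** W ** dagger K)))\<^sup>2 \<le> 1" (is ?unit)
    and "Re (trace (E ** (L ** dagger L - K ** dagger K))) \<le> sqrt (1 - (Re (trace (L ** W ** dagger K)))\<^sup>2)" (is ?bound)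
proof -
  define a where "a = L ** W"
  define Z where "Z = 2 *\<^sub>R E - mat 1"
  define c where "c = 1 - inner a a"
  define f where "f = Re (trace (L ** W ** dagger K))"
  define t where "t = Re (trace (E ** (L ** dagger L - K ** dagger K)))"
  have dZ: "dagger Z = Z" by (simp add: Z_def dagger_linear psd_hermitian[OF E(1)])
  have inner_alt: "inner x y = Re (trace (y ** dagger x))" for x y :: "complex^'n^'n"
    by (simp add: inner_matrix trace_mul_sym[of y])
  have "psd (L ** (mat 1 - W ** dagger W) ** dagger L)" by (rule psd_congruence'[OF W])
  then have D: "psd (L ** dagger L - a ** dagger a)"
    by (simp add: a_def dagger_mult matrix_ring matrix_mul_assoc)
  have c: "c = Re (trace (L ** dagger L - a ** dagger a))"
    by (simp add: c_def inner_alt Re_trace_linear tr)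
  have "0 \<le> c" unfolding c by (rule psd_trace_nonneg[OF D])
  have bb: "inner K K = 1" by (simp add: inner_alt tr)
  have ab: "inner K a = f" by (simp add: inner_alt a_def f_def)
  \<comment> \<open>\<open>Z\<close> has spectrum in [-1, 1], because \<open>mat 1 - Z ** Z\<close>
    is four times \<open>E - E ** E\<close>.\<close>
  have contr: "norm (Z ** y) \<le> norm y" for y :: "complex^'n^'n"
  proof -
    have "psd (4 *\<^sub>R (E - E ** E))" by (intro psd_scaleR effect_minus_square_psd E) simp
    also have "4 *\<^sub>R (E - E ** E) = (2 *\<^sub>R E + 2 *\<^sub>R E) - 4 *\<^sub>R (E ** E)"
      by (simp add: scaleR_diff_right scaleR_add_left[symmetric])
    also have "\<dots> = mat 1 - Z ** Z" by (simp add: Z_def matrix_ring scaleR_diff_right)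
    finally have "0 \<le> Re (trace (dagger y ** (mat 1 - Z ** Z) ** y))"
      by (intro psd_trace_nonneg psd_congruence)
    then have "inner (Z ** y) (Z ** y) \<le> inner y y"
      by (simp add: inner_matrix dagger_mult dZ matrix_ring Re_trace_linear matrix_mul_assoc)
    then show ?thesis by (simp add: norm_le)
  qed
  have "2 * t = Re (trace (Z ** (L ** dagger L - K ** dagger K)))"
    by (simp add: t_def Z_def matrix_ring Re_trace_linear tr)
  also have "\<dots> = Re (trace (Z ** (a ** dagger a))) - Re (trace (Z ** (K ** dagger K))) +
      Re (trace (Z ** (L ** dagger L - a ** dagger a)))"
    by (simp add: matrix_ring Re_trace_linear)
  also have "Re (trace (Z ** (L ** dagger L - a ** dagger a))) \<le> c"
  proof -
    have "0 \<le> Re (trace (2 *\<^sub>R ((mat 1 - E) ** (L ** dagger L - a ** dagger a))))"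
      using Re_trace_mult_nonneg[OF E(2) D] by (simp add: Re_trace_linear)
    also have "2 *\<^sub>R ((mat 1 - E) ** Y) = Y - Z ** Y" for Y :: "complex^'n^'n"
      using scaleR_2[of Y] by (simp add: Z_def matrix_ring scaleR_diff_right)
    finally show ?thesis by (simp add: c Re_trace_linear)
  qed
  also have "Re (trace (Z ** (a ** dagger a))) - Re (trace (Z ** (K ** dagger K))) =
      inner (a - K) (Z ** (a + K))"
  proof -
    have "inner K (Z ** a) = inner a (Z ** K)"
      by (metis dZ dagger_mult inner_commute inner_matrix matrix_mul_assoc)
    then show ?thesis by (simp add: matrix_ring inner_diff_left inner_add_right inner_alt dagger_linear Re_trace_linear matrix_mul_assoc)
  qed
  also have "\<dots> \<le> norm (a - K) * norm (a + K)"
    by (rule order_trans[OF norm_cauchy_schwarz]) (intro mult_left_mono contr norm_ge_zero)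
  finally have t: "2 * t \<le> norm (a - K) * norm (a + K) + c" by simp
  have u: "(norm (a - K))\<^sup>2 = 2 - c - 2 * f" and v: "(norm (a + K))\<^sup>2 = 2 - c + 2 * f"
    by (simp_all add: power2_norm_eq_inner inner_diff inner_add inner_commute[of a K] ab bb c_def)
  \<comment> \<open>After the inequality of arithmetic and geometric means the right side factors as
    \<open>(u + c) * (v + c)\<close>, with \<open>u\<close> and \<open>v\<close> the two squared
    norms; by their values this is \<open>(2 - 2 * f) * (2 + 2 * f)\<close>.\<close>
  have "(norm (a - K) * norm (a + K) + c)\<^sup>2 =
      (norm (a - K))\<^sup>2 * (norm (a + K))\<^sup>2 + c * (2 * norm (a - K) * norm (a + K)) + c\<^sup>2"
    by (simp add: power2_sum power_mult_distrib)
  also have "\<dots> \<le> (norm (a - K))\<^sup>2 * (norm (a + K))\<^sup>2 + c * ((norm (a - K))\<^sup>2 + (norm (a + K))\<^sup>2) + c\<^sup>2"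
    by (intro add_mono mult_left_mono sum_squares_bound order_refl \<open>0 \<le> c\<close>)
  also have "\<dots> = 4 * (1 - f\<^sup>2)"
    unfolding u v by (simp add: power2_eq_square algebra_simps)
  finally have sq: "(norm (a - K) * norm (a + K) + c)\<^sup>2 \<le> 4 * (1 - f\<^sup>2)" .
  then have "0 \<le> 4 * (1 - f\<^sup>2)" by (rule order_trans[OF zero_le_power2])
  then show ?unit by (simp add: f_def)
  from sq have "norm (a - K) * norm (a + K) + c \<le> sqrt (4 * (1 - f\<^sup>2))" by (rule real_le_rsqrt)
  then have "2 * t \<le> sqrt 4 * sqrt (1 - f\<^sup>2)" using t by (simp only: real_sqrt_mult)
  then show ?bound by (simp add: t_def f_def)
qed


text \<open>The tangent to the unit circle at \<open>(1/4, sqrt 15 / 4)\<close> makes the bound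
  linear, so that it can be summed over the pairs.\<close>

lemma effect_difference_fidelity_linear:
  fixes L K W E :: "complex^'n^'n"
  assumes "Re (trace (L ** dagger L)) = 1" "Re (trace (K ** dagger K)) = 1"
    and "psd (mat 1 - W ** dagger W)" and "psd E" "psd (mat 1 - E)"
  shows "Re (trace (L ** W ** dagger K)) \<le> 4 - sqrt 15 * Re (trace (E ** (L ** dagger L - K ** dagger K)))"
proof -
  define f where "f = Re (trace (L ** W ** dagger K))"
  note fid = effect_difference_fidelity[OF assms, folded f_def]
  \<comment> \<open>This square is exactly \<open>(4 - f)\<^sup>2 - 15 * (1 - f\<^sup>2)\<close>; it
    vanishes at the point of tangency.\<close>
  have "0 \<le> (4 * f - 1)\<^sup>2" by simp
  then have "15 * (1 - f\<^sup>2) \<le> (4 - f)\<^sup>2" by (simp add: power2_eq_square algebra_simps)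
  moreover have "f \<le> 4" using abs_le_square_iff[of f 1] fid(1) by simp
  ultimately have "sqrt (15 * (1 - f\<^sup>2)) \<le> 4 - f" by (intro real_le_lsqrt) simp_all
  moreover have "sqrt 15 * Re (trace (E ** (L ** dagger L - K ** dagger K))) \<le> sqrt 15 * sqrt (1 - f\<^sup>2)"
    using fid(2) by (rule mult_left_mono) simp
  ultimately show ?thesis unfolding real_sqrt_mult f_def[symmetric] by linarith
qed

section \<open>The two bounds\<close>

lemma pair_success:
  fixes \<rho> :: "nat \<Rightarrow> complex^'n^'n"
  assumes "i \<noteq> j" and tr: "Re (trace (\<rho> j)) = 1"
  obtains E where "psd E" "psd (mat 1 - E)"
    "max_success \<rho> {i, j} = 1 + Re (trace (E ** (\<rho> i - \<rho> j)))"
proof -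
  obtain M where M: "povm {i, j} M" "max_success \<rho> {i, j} = score \<rho> {i, j} M"
    using max_success_is_max(1)[of "{i, j}" \<rho>] by auto
  have *: "psd (M i)" "psd (M j)" "M i + M j = mat 1"
    using M(1) assms(1) by (auto simp: povm_def)
  then have Mj: "M j = mat 1 - M i" by (metis add_diff_cancel_left')
  have "score \<rho> {i, j} M = 1 + Re (trace (M i ** (\<rho> i - \<rho> j)))"
    using assms(1) tr
    by (simp add: score_def Mj matrix_ring Re_trace_linear trace_mul_sym[of "\<rho> _"])
  with * M(2) Mj show ?thesis by (intro that[of "M i"]) auto
qed

text \<open>The variance of an observable, the expectation of \<open>(C - m)\<^sup>2\<close> about
  its mean \<open>m\<close>, is nonnegative.\<close>

lemma psd_variance:
  fixes C :: "complex^'n^'n"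
  assumes "psd \<rho>" "Re (trace \<rho>) = 1" "dagger C = C"
  shows "(Re (trace (\<rho> ** C)))\<^sup>2 \<le> Re (trace (\<rho> ** (C ** C)))"
proof -
  define m where "m = Re (trace (\<rho> ** C))"
  have "psd ((C - m *\<^sub>R mat 1) ** (C - m *\<^sub>R mat 1))"
    by (rule psd_square) (simp add: dagger_linear assms(3))
  from Re_trace_mult_nonneg[OF assms(1) this] show ?thesis
    by (simp add: matrix_ring Re_trace_linear assms(2) m_def[symmetric] power2_eq_square)
qed

lemma cyclic_differences_square_le:
  fixes X Y Z :: "complex^'n^'n"
  assumes "psd X" "psd (mat 1 - X)" "psd Y" "psd (mat 1 - Y)" "psd Z" "psd (mat 1 - Z)"
  shows "psd ((9/4) *\<^sub>R mat 1 - ((X - Z) ** (X - Z) + (Y - X) ** (Y - X) + (Z - Y) ** (Z - Y)))"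
proof -
  \<comment> \<open>The shift 3/2 is the maximiser of \<open>3 * q - q\<^sup>2\<close>, whose
    maximum is 9/4.\<close>
  define T where "T = X + Y + Z - (3/2) *\<^sub>R mat 1"
  have "psd (T ** T)"
    by (rule psd_square) (simp add: T_def dagger_linear psd_hermitian assms)
  moreover have "psd (3 *\<^sub>R ((X - X ** X) + (Y - Y ** Y) + (Z - Z ** Z)))"
    by (intro psd_scaleR psd_add effect_minus_square_psd assms) simp
  moreover have "(9/4) *\<^sub>R mat 1 - ((X - Z) ** (X - Z) + (Y - X) ** (Y - X) + (Z - Y) ** (Z - Y)) =
      T ** T + 3 *\<^sub>R ((X - X ** X) + (Y - Y ** Y) + (Z - Z ** Z))"
    by (simp add: T_def matrix_ring)
      (simp add: vec_eq_iff scaleR_conv_of_real[where 'a = complex] algebra_simps)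
  ultimately show ?thesis by (simp only: psd_add)
qed

lemma three_state_score_bound:
  fixes \<rho> :: "nat \<Rightarrow> complex^'n^'n"
  assumes \<rho>: "psd (\<rho> 1)" "psd (\<rho> 2)" "psd (\<rho> 3)"
    and tr: "Re (trace (\<rho> 1)) = 1" "Re (trace (\<rho> 2)) = 1" "Re (trace (\<rho> 3)) = 1"
    and XYZ: "psd X" "psd (mat 1 - X)" "psd Y" "psd (mat 1 - Y)" "psd Z" "psd (mat 1 - Z)"
    and s: "3 * s = Re (trace (X ** (\<rho> 1 - \<rho> 2))) + Re (trace (Y ** (\<rho> 2 - \<rho> 3))) + Re (trace (Z ** (\<rho> 3 - \<rho> 1)))"
  obtains M where "povm {1, 2, 3} M" "1 + 4 * s\<^sup>2 / 3 \<le> score \<rho> {1, 2, 3} M"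
proof -
  define B where "B i = (if i = 1 then X - Z else if i = 2 then Y - X else Z - Y)" for i :: nat
  \<comment> \<open>This \<open>r\<close> maximises the guaranteed score
    \<open>(1 + r * s)\<^sup>2 / (1 + 3 * r\<^sup>2 / 4)\<close>, and \<open>c\<close> below
    normalises: \<open>3 + 9 * r\<^sup>2 / 4 = 3 + 4 * s\<^sup>2\<close>.\<close>
  define r where "r = 4 * s / 3"
  define c where "c = 1 / (3 + 4 * s\<^sup>2)"
  define C where "C i = mat 1 + r *\<^sub>R B i" for i
  \<comment> \<open>\<open>G\<close> is the slack in the bound 9/4. Giving it to outcome 1 makes the
    effects sum to the identity; the terms linear in \<open>r\<close> cancel because the
    \<open>B i\<close> sum to zero.\<close>
  define G where "G = (9/4) *\<^sub>R mat 1 - (B 1 ** B 1 + B 2 ** B 2 + B 3 ** B 3)"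
  define M where "M i = c *\<^sub>R (C i ** C i) + (if i = 1 then (c * r\<^sup>2) *\<^sub>R G else 0)" for i
  have pos: "0 < 3 + 4 * s\<^sup>2" by (simp add: add_pos_nonneg)
  then have c: "0 \<le> c" by (simp add: c_def)
  have G: "psd G" using cyclic_differences_square_le[OF XYZ] by (simp add: G_def B_def)
  have dB: "dagger (B i) = B i" for i by (simp add: B_def dagger_linear psd_hermitian XYZ)
  have dC: "dagger (C i) = C i" for i by (simp add: C_def dagger_linear dB)
  have B0: "B 1 + B 2 + B 3 = 0" by (simp add: B_def)
  have "psd (M i)" for i
    unfolding M_def using c by (auto intro!: psd_add psd_scaleR psd_square dC G psd_0)
  moreover have "M 1 + M 2 + M 3 = mat 1"
  proof -
    have "C 1 ** C 1 + C 2 ** C 2 + C 3 ** C 3 + r\<^sup>2 *\<^sub>R G =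
        (3 + 4 * s\<^sup>2) *\<^sub>R mat 1 + (2 * r) *\<^sub>R (B 1 + B 2 + B 3)"
      by (simp add: C_def G_def matrix_ring)
        (simp add: vec_eq_iff scaleR_conv_of_real[where 'a = complex] r_def power2_eq_square algebra_simps)
    moreover have "M 1 + M 2 + M 3 = c *\<^sub>R (C 1 ** C 1 + C 2 ** C 2 + C 3 ** C 3 + r\<^sup>2 *\<^sub>R G)"
      by (simp add: M_def algebra_simps)
    ultimately show ?thesis using pos by (simp add: B0 c_def del: One_nat_def)
  qed
  ultimately have povm: "povm {1, 2, 3} M" by (simp add: povm_def add.assoc)
  define b where "b i = Re (trace (\<rho> i ** B i))" for i
  have b: "c * (1 + r * b i)\<^sup>2 \<le> Re (trace (\<rho> i ** M i))" if "psd (\<rho> i)" "Re (trace (\<rho> i)) = 1" for i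
  proof -
    have "(1 + r * b i)\<^sup>2 \<le> Re (trace (\<rho> i ** (C i ** C i)))"
      using psd_variance[OF that dC, of i]
      by (simp add: C_def b_def matrix_ring Re_trace_linear that)
    then have "c * (1 + r * b i)\<^sup>2 \<le> c * Re (trace (\<rho> i ** (C i ** C i)))"
      using c by (rule mult_left_mono)
    moreover have "0 \<le> c * r\<^sup>2 * Re (trace (\<rho> i ** G))"
      using c Re_trace_mult_nonneg[OF that(1) G] by simp
    ultimately show ?thesis
      by (cases "i = 1") (simp_all add: M_def bounded_bilinear.add_right[OF bounded_bilinear_matrix_mult]
          bounded_bilinear.scaleR_right[OF bounded_bilinear_matrix_mult] matrix_ring(8) Re_trace_linear)
  qed
  \<comment> \<open>Regrouping by effects instead of states: \<open>X\<close> multiplies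
    \<open>\<rho> 1 - \<rho> 2\<close>, and so on cyclically.\<close>
  have bs: "b 1 + b 2 + b 3 = 3 * s"
    by (simp add: s b_def B_def matrix_ring Re_trace_linear trace_mul_sym[of "\<rho> _"])
  \<comment> \<open>The three \<open>b i\<close> have mean \<open>s\<close>, so the sum of their
    squares is least when they are equal.\<close>
  have "0 \<le> (b 1 - b 2)\<^sup>2 + (b 2 - b 3)\<^sup>2 + (b 1 - b 3)\<^sup>2" by simp
  then have "3 * s\<^sup>2 \<le> (b 1)\<^sup>2 + (b 2)\<^sup>2 + (b 3)\<^sup>2"
  proof -
    have "(b 1 + b 2 + b 3)\<^sup>2 = 9 * s\<^sup>2" unfolding bs by (simp add: power_mult_distrib)
    with \<open>0 \<le> (b 1 - b 2)\<^sup>2 + (b 2 - b 3)\<^sup>2 + (b 1 - b 3)\<^sup>2\<close> show ?thesis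
      by (simp add: power2_eq_square algebra_simps)
  qed
  then have "r\<^sup>2 * (3 * s\<^sup>2) \<le> r\<^sup>2 * ((b 1)\<^sup>2 + (b 2)\<^sup>2 + (b 3)\<^sup>2)"
    by (rule mult_left_mono) simp
  moreover have "(1 + r * b 1)\<^sup>2 + (1 + r * b 2)\<^sup>2 + (1 + r * b 3)\<^sup>2 =
      3 + 2 * r * (3 * s) + r\<^sup>2 * ((b 1)\<^sup>2 + (b 2)\<^sup>2 + (b 3)\<^sup>2)"
    unfolding bs[symmetric] by (simp add: power2_eq_square algebra_simps)
  ultimately have "3 * (1 + r * s)\<^sup>2 \<le> (1 + r * b 1)\<^sup>2 + (1 + r * b 2)\<^sup>2 + (1 + r * b 3)\<^sup>2"
    by (simp add: power2_eq_square algebra_simps)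
  then have "c * (3 * (1 + r * s)\<^sup>2) \<le> c * ((1 + r * b 1)\<^sup>2 + (1 + r * b 2)\<^sup>2 + (1 + r * b 3)\<^sup>2)"
    using c by (rule mult_left_mono)
  also have "\<dots> \<le> score \<rho> {1, 2, 3} M"
    using b[OF \<rho>(1) tr(1)] b[OF \<rho>(2) tr(2)] b[OF \<rho>(3) tr(3)]
    by (simp add: score_def distrib_left)
  also have "c * (3 * (1 + r * s)\<^sup>2) = 1 + 4 * s\<^sup>2 / 3"
    using pos by (simp add: c_def r_def divide_simps) (simp add: power2_eq_square algebra_simps)
  finally show ?thesis using that povm by blast
qed

theorem mainTheorem7:
  fixes \<rho> :: "nat \<Rightarrow> complex^'n^'n"
  assumes "density_matrix (\<rho> 1)" and "density_matrix (\<rho> 2)" and "density_matrix (\<rho> 3)"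
  shows "beta \<rho> \<le> (3 * sqrt 15 - 9) / 4 \<and> (3 * sqrt 15 - 9) / 4 < (2 / 3 :: real)"
proof
  have pos: "psd (\<rho> 1)" "psd (\<rho> 2)" "psd (\<rho> 3)"
    and tr: "Re (trace (\<rho> 1)) = 1" "Re (trace (\<rho> 2)) = 1" "Re (trace (\<rho> 3)) = 1"
    using assms by (simp_all add: density_matrix_def)
  obtain X where X: "psd X" "psd (mat 1 - X)" "max_success \<rho> {1, 2} = 1 + Re (trace (X ** (\<rho> 1 - \<rho> 2)))"
    by (rule pair_success[of 1 2 \<rho>]) (use tr in auto)
  obtain Y where Y: "psd Y" "psd (mat 1 - Y)" "max_success \<rho> {2, 3} = 1 + Re (trace (Y ** (\<rho> 2 - \<rho> 3)))"
    by (rule pair_success[of 2 3 \<rho>]) (use tr in auto)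
  \<comment> \<open>The pair is taken as (3, 1) to keep the cyclic orientation used for the
    differences \<open>B i\<close>.\<close>
  obtain Z where Z: "psd Z" "psd (mat 1 - Z)" "max_success \<rho> {3, 1} = 1 + Re (trace (Z ** (\<rho> 3 - \<rho> 1)))"
    by (rule pair_success[of 3 1 \<rho>]) (use tr in auto)
  define x where "x = Re (trace (X ** (\<rho> 1 - \<rho> 2)))"
  define y where "y = Re (trace (Y ** (\<rho> 2 - \<rho> 3)))"
  define z where "z = Re (trace (Z ** (\<rho> 3 - \<rho> 1)))"
  define s where "s = (x + y + z) / 3"
  define D where "D = max_success \<rho> {1, 2, 3}"
  have beta: "beta \<rho> = 3 * s - D"
    by (simp add: beta_def min_error_def X(3) Y(3) Z(3)[unfolded insert_commute[of 3 1]]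
        D_def s_def x_def y_def z_def del: One_nat_def)
  have D: "score \<rho> {1, 2, 3} M \<le> D" if "povm {1, 2, 3} M" for M
    unfolding D_def by (rule max_success_is_max(2)[OF _ _ that]) auto
  obtain M where "povm {1, 2, 3} M" "1 + 4 * s\<^sup>2 / 3 \<le> score \<rho> {1, 2, 3} M"
    by (rule three_state_score_bound[OF pos tr X(1,2) Y(1,2) Z(1,2), of s])
      (auto simp: s_def x_def y_def z_def)
  with D have D1: "1 + 4 * s\<^sup>2 / 3 \<le> D" by force
  \<comment> \<open>The tangent bound for each unordered pair; the last branch is reached only for
    {1, 3} among the pairs that occur.\<close>
  define F where "F i j = 4 - sqrt 15 * (if {i, j} = {1, 2} then x else if {i, j} = {2, 3} then y else z)" for i j :: nat
  have F: "Re (trace (L ** W ** dagger K)) \<le> F i j"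
    if "i \<in> {1, 2, 3}" "j \<in> {1, 2, 3}" "i \<noteq> j" "\<rho> i = L ** dagger L" "\<rho> j = K ** dagger K"
      "psd (mat 1 - W ** dagger W)" for i j and L K W :: "complex^'n^'n"
  proof -
    have ij: "Re (trace (\<rho> i)) = 1" "Re (trace (\<rho> j)) = 1" using that(1,2) tr by auto
    note lin = effect_difference_fidelity_linear[of L K W, folded that(4,5), OF ij that(6)]
    \<comment> \<open>For a pair met in the opposite orientation, the complementary effect gives the
      same advantage.\<close>
    have swap: "Re (trace ((mat 1 - E) ** (\<rho> i - \<rho> j))) = Re (trace (E ** (\<rho> j - \<rho> i)))" for E
      using ij by (simp add: matrix_ring Re_trace_linear)
    have lin': "Re (trace (L ** W ** dagger K)) \<le> 4 - sqrt 15 * Re (trace (E ** (\<rho> j - \<rho> i)))"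
      if "psd E" "psd (mat 1 - E)" for E
      using lin[of "mat 1 - E"] that by (simp add: swap)
    show ?thesis
      using that(1-3) lin[OF X(1,2)] lin[OF Y(1,2)] lin[OF Z(1,2)] lin'[OF X(1,2)] lin'[OF Y(1,2)] lin'[OF Z(1,2)]
      by (auto simp: F_def doubleton_eq_iff x_def y_def z_def)
  qed
  obtain M where M: "povm {1, 2, 3} M"
    "2 * ((\<Sum>i\<in>{1, 2, 3}. Re (trace (\<rho> i))) - score \<rho> {1, 2, 3} M) \<le> (\<Sum>i\<in>{1, 2, 3}. \<Sum>j\<in>{1, 2, 3} - {i}. F i j)"
    by (rule pretty_good_measurement[of "{1, 2, 3}" \<rho> F]) (use pos F in auto)
  have "(\<Sum>i\<in>{1, 2, 3}. \<Sum>j\<in>{1, 2, 3} - {i}. F i j) = 2 * (12 - sqrt 15 * (3 * s))"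
    by (simp add: F_def doubleton_eq_iff insert_Diff_if s_def algebra_simps)
  then have "3 - score \<rho> {1, 2, 3} M \<le> 12 - sqrt 15 * (3 * s)"
    using M(2) tr by simp
  with D[OF M(1)] have D2: "sqrt 15 * (3 * s) - 9 \<le> D" by simp
  show "beta \<rho> \<le> (3 * sqrt 15 - 9) / 4"
  proof (cases "s \<le> sqrt 15 / 4")
    case True
    \<comment> \<open>From \<open>sqrt 15 \<le> 4\<close> both \<open>s\<close> and
      \<open>sqrt 15 / 4\<close> are at most 1, so the second factor below is positive:
      \<open>3 * s - 1 - 4 * s\<^sup>2 / 3\<close> still increases up to the crossing point.\<close>
    have "sqrt 15 \<le> sqrt (4\<^sup>2)" by (subst real_sqrt_le_iff) simp
    then have "0 \<le> (sqrt 15 / 4 - s) * (3 - 4 / 3 * (s + sqrt 15 / 4))"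
      using True by (intro mult_nonneg_nonneg) simp_all
    also have "\<dots> = (3 * sqrt 15 - 9) / 4 - (3 * s - (1 + 4 * s\<^sup>2 / 3))"
      by (simp add: power2_eq_square field_simps)
    finally show ?thesis using D1 by (simp add: beta)
  next
    case False
    \<comment> \<open>Past the crossing point \<open>3 * s - (3 * sqrt 15 * s - 9)\<close> decreases
      in \<open>s\<close>, and at \<open>s = sqrt 15 / 4\<close> it equals the claimed
      constant.\<close>
    have "1 \<le> sqrt 15" by simp
    then have "(sqrt 15 - 1) * (sqrt 15 / 4) \<le> (sqrt 15 - 1) * s"
      using False by (intro mult_left_mono) simp_all
    then have "15 / 4 - sqrt 15 / 4 + s \<le> sqrt 15 * s" by (simp add: field_simps)
    moreover have "3 * (sqrt 15 * s) - 9 \<le> D" using D2 by (simp add: mult.left_commute)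
    ultimately show ?thesis unfolding beta by argo
  qed
  \<comment> \<open>The strict inequality rearranges to \<open>sqrt 15 < 35/9\<close>.\<close>
  have "sqrt 15 < sqrt ((35/9)\<^sup>2)" by (subst real_sqrt_less_iff) (simp add: power2_eq_square)
  then show "(3 * sqrt 15 - 9) / 4 < (2 / 3 :: real)" by simp
qed

end
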